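(* For every $x\in X$ the following estimates hold: $$\|\operatorname{grad}J^B(x)\|_{\mathcal E}\le\|G_x\|_{\widetilde g_x}=\|(P_x^B)^*\operatorname{grad}J(x)\|_{\mathcal E}\le K_B\|\operatorname{grad}J^B(x)\|_{\mathcal E},$$ $$\|\operatorname{grad}J^B(x)\|_{\mathcal E}\le\|G_x\|_{\mathcal E}\le K_B^2\|\operatorname{grad}J^B(x)\|_{\mathcal E},$$ $$\bigl(G_x,\operatorname{grad}J^B(x)\bigr)_{\mathcal E}\ge\frac1{K_B^2}\|G_x\|_{\mathcal E}\,\|\operatorname{grad}J^B(x)\|_{\mathcal E}.$$
   Context: $\mathcal E,\mathcal Y$ are real Hilbert spaces. $\mathcal M\subset\mathcal E$ is a $C^2$ embedded submanifold; for $x\in\mathcal M$ the tangent space $T_x\mathcal M$ is identified with a closed linear subspace of $\mathcal E$. $B:\mathcal E\to\mathcal Y$ is a surjective bounded linear operator with adjoint $B^*$, $c\in\mathcal Y$, and $\mathcal M^B:=\{x\in\mathcal M: Bx=c\}$ is nonempty. For each $x\in\mathcal M$ a bounded linear projection $P_x:\mathcal E\to T_x\mathcal M$ onto $T_x\mathcal M$ is given (not necessarily orthogonal), and $L_x:=BP_xB^*:\mathcal Y\to\mathcal Y$. Standing assumptions: (A1) for every bounded $S\subset\mathcal M^B$ there is $C_S>0$ with $(L_x\delta,\delta)_{\mathcal Y}\ge C_S\|\delta\|_{\mathcal Y}^2$ for all $x\in S$, $\delta\in\mathcal Y$ (so $L_x$ is boundedly invertible); (A2) the map $\mathcal M\to\mathcal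 L(\mathcal E,\mathcal E)$, $x\mapsto P_x$, is continuous and maps bounded sets to bounded sets. Then $\mathcal M^B$ is a $C^2$ Hilbert submanifold with $T_x\mathcal M^B=T_x\mathcal M\cap\ker B$ and ambient Riemannian metric $(u,v)_x=(u,v)_{\mathcal E}$, and $P_x^B:=P_x-P_xB^*L_x^{-1}BP_x$ is a bounded projection of $\mathcal E$ onto $T_x\mathcal M^B$ with adjoint $(P_x^B)^*$ on $\mathcal E$. $X\subset\mathcal M^B$ is a fixed bounded set and $K_B>0$ is a constant with $\|P_x^B\|\le K_B$ for all $x\in X$ (such a constant exists). $J:\mathcal E\to\mathbb R$ is $C^2$ with gradient $\operatorname{grad}J$; $J^B:=J|_{\mathcal M^B}$; $\operatorname{grad}J^B(x)\in T_x\mathcal M^B$ is the Riemannian gradient for the ambient metric, i.e. $(\operatorname{grad}J^B(x),v)_{\mathcal E}=(\operatorname{grad}J(x),v)_{\mathcal E}$ for all $v\in T_x\mathcal M^B$. $G_x:=P_x^B(P_x^B)^*\operatorname{grad}J(x)\in T_x\mathcal M^B$. The operator $A_x:=P_x^B(P_x^B)^*|_{T_x\mathcal M^B}$ is self-adjoint, positive definite and boundedly invertible on $T_x\mathcal M^B$; $\widetilde g_x(u,v):=(A_x^{-1}u,v)_{\mathcal E}$ and $\|v\|_{\widetilde g_x}:=\sqrt{\widetilde g_x(v,v)}$ for $u,v\in T_x\mathcal M^B$. *)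

theory Defs
  imports "HOL-Analysis.Analysis"
begin

text \<open>Real Hilbert spaces are types of sort \<open>{real_inner, complete_space}\<close>.\<close>

definition C2_on :: "('a::real_normed_vector \<Rightarrow> 'b::real_normed_vector) \<Rightarrow> 'a set \<Rightarrow> bool"
  where "C2_on f U \<longleftrightarrow>
    (\<exists>(f' :: 'a \<Rightarrow> 'a \<Rightarrow>\<^sub>L 'b) (f'' :: 'a \<Rightarrow> 'a \<Rightarrow>\<^sub>L ('a \<Rightarrow>\<^sub>L 'b)).
      (\<forall>x\<in>U. (f has_derivative blinfun_apply (f' x)) (at x)) \<and>
      (\<forall>x\<in>U. (f' has_derivative blinfun_apply (f'' x)) (at x)) \<and>
      continuous_on U f'')"

text \<open>Around each of its points, an embedded \<open>C\<^sup>2\<close> submanifold is straightened to a closed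
  linear subspace \<open>H\<close> by a \<open>C\<^sup>2\<close> diffeomorphism \<open>\<phi>\<close> of open subsets of the ambient Hilbert
  space. Closed subspaces of a Hilbert space split, so no complement has to be required;
  \<open>H\<close> may be infinite-dimensional and may depend on the point.\<close>

definition C2_submanifold :: "'a::{real_inner, complete_space} set \<Rightarrow> bool"
  where "C2_submanifold M \<longleftrightarrow>
    (\<forall>x\<in>M. \<exists>U V (\<phi> :: 'a \<Rightarrow> 'a) \<psi> H.
      open U \<and> x \<in> U \<and> open V \<and> homeomorphism U V \<phi> \<psi> \<and> C2_on \<phi> U \<and> C2_on \<psi> V \<and>
      subspace H \<and> closed H \<and> \<phi> ` (M \<inter> U) = H \<inter> V)"

text \<open>The tangent space consists of the velocities at \<open>x\<close> of the \<open>C\<^sup>1\<close> curves in \<open>S\<close> through \<open>x\<close>.\<close>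

definition tangent_space :: "'a::real_normed_vector set \<Rightarrow> 'a \<Rightarrow> 'a set"
  where "tangent_space S x =
    {v. \<exists>(\<gamma> :: real \<Rightarrow> 'a) \<gamma>' \<epsilon>. \<epsilon> > 0 \<and> \<gamma> 0 = x \<and> \<gamma>' 0 = v \<and>
      (\<forall>t\<in>{-\<epsilon><..<\<epsilon>}. \<gamma> t \<in> S \<and> (\<gamma> has_vector_derivative \<gamma>' t) (at t)) \<and>
      continuous_on {-\<epsilon><..<\<epsilon>} \<gamma>'}"

definition grad :: "('a::real_inner \<Rightarrow> real) \<Rightarrow> 'a \<Rightarrow> 'a"
  where "grad J x = (THE g. GDERIV J x :> g)"

text \<open>The gradient of \<open>J\<close> restricted to \<open>S\<close>, for the metric induced by the ambient inner
  product.\<close>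

definition riemannian_grad :: "('a::real_inner \<Rightarrow> real) \<Rightarrow> 'a set \<Rightarrow> 'a \<Rightarrow> 'a"
  where "riemannian_grad J S x =
    (THE g. g \<in> tangent_space S x \<and> (\<forall>v\<in>tangent_space S x. g \<bullet> v = grad J x \<bullet> v))"

definition constrained_set ::
    "'e set \<Rightarrow> ('e::real_normed_vector \<Rightarrow>\<^sub>L 'y::real_normed_vector) \<Rightarrow> 'y \<Rightarrow> 'e set"
  where "constrained_set M B c = {x \<in> M. blinfun_apply B x = c}"

definition L_op ::
    "('e::real_inner \<Rightarrow>\<^sub>L 'y::real_inner) \<Rightarrow> ('e \<Rightarrow> 'e \<Rightarrow>\<^sub>L 'e) \<Rightarrow> 'e \<Rightarrow> 'y \<Rightarrow> 'y"
  where "L_op B P x \<delta> = blinfun_apply B (blinfun_apply (P x) (adjoint (blinfun_apply B) \<delta>))"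

definition PB_op ::
    "('e::real_inner \<Rightarrow>\<^sub>L 'y::real_inner) \<Rightarrow> ('e \<Rightarrow> 'e \<Rightarrow>\<^sub>L 'e) \<Rightarrow> 'e \<Rightarrow> 'e \<Rightarrow> 'e"
  where "PB_op B P x v =
    blinfun_apply (P x) v -
    blinfun_apply (P x) (adjoint (blinfun_apply B)
      (inv (L_op B P x) (blinfun_apply B (blinfun_apply (P x) v))))"

definition G_vec ::
    "('e::real_inner \<Rightarrow>\<^sub>L 'y::real_inner) \<Rightarrow> ('e \<Rightarrow> 'e \<Rightarrow>\<^sub>L 'e) \<Rightarrow> ('e \<Rightarrow> real) \<Rightarrow> 'e \<Rightarrow> 'e"
  where "G_vec B P J x = PB_op B P x (adjoint (PB_op B P x) (grad J x))"

text \<open>\<open>A_op\<close> is the restriction to the tangent space of \<open>constrained_set M B c\<close> once its inverse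
  is taken on that set, as is done in \<open>g_tilde\<close>.\<close>

definition A_op ::
    "('e::real_inner \<Rightarrow>\<^sub>L 'y::real_inner) \<Rightarrow> ('e \<Rightarrow> 'e \<Rightarrow>\<^sub>L 'e) \<Rightarrow> 'e \<Rightarrow> 'e \<Rightarrow> 'e"
  where "A_op B P x v = PB_op B P x (adjoint (PB_op B P x) v)"

definition g_tilde ::
    "'e set \<Rightarrow> ('e::real_inner \<Rightarrow>\<^sub>L 'y::real_inner) \<Rightarrow> 'y \<Rightarrow> ('e \<Rightarrow> 'e \<Rightarrow>\<^sub>L 'e) \<Rightarrow> 'e \<Rightarrow> 'e \<Rightarrow> 'e \<Rightarrow> real"
  where "g_tilde M B c P x u v =
    inv_into (tangent_space (constrained_set M B c) x) (A_op B P x) u \<bullet> v"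

definition norm_g_tilde ::
    "'e set \<Rightarrow> ('e::real_inner \<Rightarrow>\<^sub>L 'y::real_inner) \<Rightarrow> 'y \<Rightarrow> ('e \<Rightarrow> 'e \<Rightarrow>\<^sub>L 'e) \<Rightarrow> 'e \<Rightarrow> 'e \<Rightarrow> real"
  where "norm_g_tilde M B c P x v = sqrt (g_tilde M B c P x v v)"

end

theory Submission
  imports Defs
begin

text \<open>At a point \<open>x\<close> of \<open>X\<close> let \<open>S\<close> be the tangent space of the constrained set,
  \<open>Q = PB_op B P x\<close>, \<open>h = grad J x\<close> and \<open>g\<close> the Riemannian gradient, which is the orthogonal
  projection of \<open>h\<close> to \<open>S\<close>. Once \<open>Q\<close> is known to be a bounded projection onto \<open>S\<close>, the
  estimates are Hilbert space geometry: \<open>Q\<^sup>*\<close> vanishes on the orthogonal complement of \<open>S\<close>, so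
  \<open>s = Q\<^sup>* h = Q\<^sup>* g\<close>; testing with \<open>g = Q g\<close> gives \<open>norm g \<le> norm s\<close>, and the operator norm
  gives \<open>norm s \<le> K * norm g\<close>. With \<open>G = Q s\<close> one has \<open>G \<bullet> g = s \<bullet> s\<close>, and since \<open>Q Q\<^sup>*\<close> is
  injective on \<open>S\<close> and sends \<open>g\<close> to \<open>G\<close>, this number is also the squared modified norm of
  \<open>G\<close> (\<open>projection_gradient_estimates\<close>).

  That \<open>Q\<close> projects onto \<open>S\<close> has an algebraic and an analytic part. Algebraically, \<open>Q\<close> is a
  projection onto \<open>T \<inter> ker B\<close>, where \<open>T\<close> is the tangent space of \<open>M\<close>; this needs the bounded
  inverse of the coercive operator \<open>L_op B P x\<close>, from the Lax--Milgram lemma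
  (\<open>PB_op_projection\<close>). Analytically, \<open>T \<inter> ker B\<close> has to be the set of velocities of \<open>C\<^sup>1\<close>
  curves in the constrained set (\<open>tangent_space_constrained_set\<close>). For this, a straight line in
  a chart of \<open>M\<close> is corrected so that it satisfies the constraint, by an implicit function
  argument (\<open>implicit_curve\<close>) whose nondegeneracy condition is again the coercivity of
  \<open>L_op B P x\<close>. Both the linear and the nonlinear equations are solved by the same contraction
  (\<open>strongly_monotone_zero\<close>), and the adjoints and the orthogonal projection exist by the Riesz
  representation on a closed subspace (\<open>riesz_on_subspace\<close>).\<close>

section \<open>Coercive equations in Hilbert space\<close>

text \<open>A coercivity inequality bounds \<open>d\<close> by \<open>y\<close>: apply Cauchy--Schwarz and cancel one factor
  \<open>norm d\<close>.\<close>

lemma coercive_cancel: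
  fixes y d :: "'a::real_inner"
  assumes "m * (norm d)\<^sup>2 \<le> y \<bullet> d"
  shows "m * norm d \<le> norm y"
proof (cases "d = 0")
  case False
  have "(m * norm d) * norm d \<le> norm y * norm d"
    using assms norm_cauchy_schwarz[of y d] by (simp add: power2_eq_square mult.assoc)
  then show ?thesis using False by simp
qed simp

text \<open>For a strongly monotone Lipschitz map \<open>f\<close>, the damped iteration \<open>u \<mapsto> u - \<rho> f u\<close> is a
  contraction: the cross term \<open>- 2 \<rho> m\<close> in the squared norm beats the quadratic term
  \<open>\<rho>\<^sup>2 N\<^sup>2\<close>, and \<open>\<rho> = m / N\<^sup>2\<close> is the optimal damping. Its fixed point is the zero. Working
  on a ball lets the same lemma solve linear coercive equations (on a large ball) and the
  nonlinear constraint equation (on a small one).\<close>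

lemma strongly_monotone_zero:
  fixes f :: "'a::{real_inner, complete_space} \<Rightarrow> 'a"
  assumes m: "0 < m" "m \<le> N" and r: "0 \<le> r"
    and mono: "\<And>u v. u \<in> cball 0 r \<Longrightarrow> v \<in> cball 0 r \<Longrightarrow> m * (norm (u - v))\<^sup>2 \<le> (f u - f v) \<bullet> (u - v)"
    and lip: "\<And>u v. u \<in> cball 0 r \<Longrightarrow> v \<in> cball 0 r \<Longrightarrow> norm (f u - f v) \<le> N * norm (u - v)"
    and small: "norm (f 0) \<le> m * r / 2"
  shows "\<exists>u\<in>cball 0 r. f u = 0"
proof -
  define \<rho> where "\<rho> = m / N\<^sup>2"
  \<comment> \<open>A rational upper bound for the exact contraction factor, the square root of \<open>1 - m\<^sup>2 / N\<^sup>2\<close>.\<close>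
  define q where "q = 1 - m\<^sup>2 / (2 * N\<^sup>2)"
  define T where "T u = u - \<rho> *\<^sub>R f u" for u
  have N: "0 < N" using m by simp
  have \<rho>: "0 < \<rho>" using m N by (simp add: \<rho>_def)
  have "m\<^sup>2 \<le> N\<^sup>2" using m by (intro power_mono) auto
  then have "m\<^sup>2 \<le> 2 * N\<^sup>2" by (rule order.trans) simp
  then have q: "0 \<le> q" "q < 1" using m N by (auto simp: q_def field_simps)
  have contr: "norm (T u - T v) \<le> q * norm (u - v)" if "u \<in> cball 0 r" "v \<in> cball 0 r" for u v
  proof -
    have eq: "T u - T v = (u - v) - \<rho> *\<^sub>R (f u - f v)"
      by (simp add: T_def algebra_simps)
    have "(norm (T u - T v))\<^sup>2 = (norm (u - v))\<^sup>2 - 2 * \<rho> * ((f u - f v) \<bullet> (u - v))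
        + \<rho>\<^sup>2 * (norm (f u - f v))\<^sup>2"
      unfolding eq power2_norm_eq_inner
      by (simp add: inner_diff_left inner_diff_right inner_commute algebra_simps power2_eq_square)
    also have "\<dots> \<le> (norm (u - v))\<^sup>2 - 2 * \<rho> * (m * (norm (u - v))\<^sup>2)
        + \<rho>\<^sup>2 * (N * norm (u - v))\<^sup>2"
      using mono[OF that] lip[OF that] \<rho>
      by (intro add_mono diff_mono mult_left_mono power_mono) auto
    also have "\<dots> = (1 - m\<^sup>2 / N\<^sup>2) * (norm (u - v))\<^sup>2"
      using N by (simp add: \<rho>_def field_simps power2_eq_square)
    also have "\<dots> \<le> q\<^sup>2 * (norm (u - v))\<^sup>2"
    proof (rule mult_right_mono)
      have "q\<^sup>2 = 1 - m\<^sup>2 / N\<^sup>2 + (m\<^sup>2 / (2 * N\<^sup>2))\<^sup>2"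
        unfolding q_def using N by (simp add: field_simps power2_eq_square)
      then show "1 - m\<^sup>2 / N\<^sup>2 \<le> q\<^sup>2" by simp
    qed simp
    finally have "(norm (T u - T v))\<^sup>2 \<le> (q * norm (u - v))\<^sup>2"
      by (simp add: power_mult_distrib)
    then show ?thesis by (rule power2_le_imp_le) (use q in simp)
  qed
  have "\<exists>!u\<in>cball 0 r. T u = u"
  proof (rule Banach_fix)
    show "complete (cball (0::'a) r)" by (simp add: complete_eq_closed)
    show "cball (0::'a) r \<noteq> {}" using r by simp
    show "T ` cball 0 r \<subseteq> cball 0 r"
    proof (rule image_subsetI)
      fix u :: 'a assume u: "u \<in> cball 0 r"
      have "norm (T u) \<le> norm (T u - T 0) + norm (T 0)"
        by (metis diff_add_cancel norm_triangle_ineq)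
      also have "norm (T u - T 0) \<le> q * r"
        using contr[OF u, of 0] r q u by (simp add: order.trans mult_left_mono)
      also have "norm (T 0) \<le> \<rho> * (m * r / 2)"
        using small \<rho> by (simp add: T_def)
      also have "q * r + \<rho> * (m * r / 2) = r"
        using N by (simp add: q_def \<rho>_def field_simps power2_eq_square)
      finally show "T u \<in> cball 0 r" by simp
    qed
  qed (use q contr in \<open>auto simp: dist_norm\<close>)
  then obtain u where "u \<in> cball 0 r" "T u = u" by blast
  then show ?thesis using \<rho> by (auto simp: T_def)
qed

text \<open>Coercivity gives injectivity and the bound \<open>1 / m\<close> for the inverse; surjectivity is the
  preceding lemma for \<open>u \<mapsto> A u - y\<close>. A variational argument is not available here: for an
  oblique projection \<open>P x\<close> the operator \<open>L_op B P x\<close> is in general not symmetric.\<close>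

lemma lax_milgram:
  fixes A :: "'a::{real_inner, complete_space} \<Rightarrow> 'a"
  assumes A: "bounded_linear A" and m: "0 < m" and coer: "\<And>u. m * (norm u)\<^sup>2 \<le> A u \<bullet> u"
  shows "bij A" and "bounded_linear (inv A)"
proof -
  interpret A: bounded_linear A by (rule A)
  have lower: "m * norm u \<le> norm (A u)" for u
    using coer[of u] by (rule coercive_cancel)
  have inj: "inj A"
  proof (rule injI)
    fix u v assume "A u = A v"
    then show "u = v" using lower[of "u - v"] m by (simp add: A.diff mult_le_0_iff)
  qed
  have "\<exists>u. A u = y" for y
  proof -
    obtain N where N: "\<And>u. norm (A u) \<le> norm u * N" using A.bounded by blast
    \<comment> \<open>This radius makes \<open>norm y\<close>, the size of the map at the origin, exactly half of \<open>m\<close> times the radius.\<close>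
    have "\<exists>u\<in>cball 0 (2 * norm y / m). A u - y = 0"
    proof (rule strongly_monotone_zero[where m = m and N = "max m N"])
      fix u v
      show "m * (norm (u - v))\<^sup>2 \<le> (A u - y - (A v - y)) \<bullet> (u - v)"
        using coer[of "u - v"] by (simp add: A.diff)
      have "norm (A (u - v)) \<le> norm (u - v) * max m N"
        by (rule order.trans[OF N]) (simp add: mult_left_mono)
      then show "norm (A u - y - (A v - y)) \<le> max m N * norm (u - v)"
        by (simp add: A.diff mult.commute)
    qed (use m in \<open>auto simp: A.zero\<close>)
    then show ?thesis by auto
  qed
  then have surj: "surj A" by (metis surjI)
  show bij: "bij A" using inj surj by (simp add: bij_def)
  have AI: "A (inv A y) = y" for y using surj by (simp add: surj_f_inv_f)
  have IA: "inv A (A u) = u" for u using inj by simp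
  show "bounded_linear (inv A)"
  proof (rule bounded_linear_intro[where K = "1 / m"])
    show "inv A (x + y) = inv A x + inv A y" for x y
      using IA[of "inv A x + inv A y"] by (simp add: A.add AI)
    show "inv A (k *\<^sub>R x) = k *\<^sub>R inv A x" for k x
      using IA[of "k *\<^sub>R inv A x"] by (simp add: A.scaleR AI)
    show "norm (inv A x) \<le> norm x * (1 / m)" for x
      using lower[of "inv A x"] m by (simp add: AI field_simps)
  qed
qed

section \<open>Riesz representation and adjoints\<close>

text \<open>The representing vector minimises \<open>x \<bullet> x - 2 f x\<close> over \<open>H\<close>. By the parallelogram law a
  minimising sequence is Cauchy, and the first variation at the limit gives the representation.
  Taking \<open>H = UNIV\<close> yields adjoints; taking \<open>f\<close> to be the inner product with a fixed vector
  yields its orthogonal projection to \<open>H\<close>, hence Riemannian gradients.\<close>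

lemma riesz_on_subspace:
  fixes f :: "'a::{real_inner, complete_space} \<Rightarrow> real"
  assumes f: "bounded_linear f" and H: "subspace H" "closed H"
  shows "\<exists>g\<in>H. \<forall>v\<in>H. g \<bullet> v = f v"
proof -
  interpret f: bounded_linear f by (rule f)
  define q where "q x = x \<bullet> x - 2 * f x" for x
  obtain K where K: "\<And>x. norm (f x) \<le> norm x * K" using f.bounded by blast
  have bdd: "bdd_below (q ` H)"
  proof (rule bdd_belowI2)
    fix x :: 'a
    have "f x \<le> norm x * K" using K[of x] by simp
    moreover have "0 \<le> (norm x - K)\<^sup>2" by simp
    ultimately show "- K\<^sup>2 \<le> q x"
      by (simp add: q_def power2_eq_square algebra_simps flip: power2_norm_eq_inner)
  qed
  have H0: "0 \<in> H" using H by (simp add: subspace_0)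
  define i where "i = Inf (q ` H)"
  have le: "i \<le> q x" if "x \<in> H" for x
    unfolding i_def using bdd that by (simp add: cInf_lower)
  have "\<exists>x\<in>H. q x < i + inverse (real (Suc n))" for n
    using cInf_less_iff[of "q ` H" "i + inverse (real (Suc n))"] bdd H0 by (auto simp: i_def)
  then obtain X where X: "\<And>n. X n \<in> H" "\<And>n. q (X n) < i + inverse (real (Suc n))" by metis
  have par: "(norm (X m - X n))\<^sup>2 \<le> 2 * (q (X m) - i) + 2 * (q (X n) - i)" for m n
  proof -
    have "i \<le> q ((1/2) *\<^sub>R (X m + X n))"
      using X(1) H by (intro le) (simp add: subspace_add subspace_scale)
    then show ?thesis
      by (simp add: q_def power2_norm_eq_inner f.add f.scaleR inner_add inner_diff inner_commute field_simps)
  qed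
  have "Cauchy X"
  proof (rule metric_CauchyI)
    fix e :: real assume "0 < e"
    then obtain N where N: "inverse (real (Suc N)) < e\<^sup>2 / 4"
      using reals_Archimedean[of "e\<^sup>2/4"] by auto
    have "dist (X m) (X n) < e" if "m \<ge> N" "n \<ge> N" for m n
    proof -
      have "inverse (real (Suc k)) \<le> inverse (real (Suc N))" if "k \<ge> N" for k
        using that by (simp add: field_simps)
      then have "q (X m) - i < e\<^sup>2/4" "q (X n) - i < e\<^sup>2/4"
        using X(2)[of m] X(2)[of n] N that by (smt (verit))+
      then have "(norm (X m - X n))\<^sup>2 < e\<^sup>2" using par[of m n] by argo
      then show ?thesis using \<open>0 < e\<close> by (simp add: dist_norm power2_less_imp_less)
    qed
    then show "\<exists>M. \<forall>m\<ge>M. \<forall>n\<ge>M. dist (X m) (X n) < e" by blast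
  qed
  then obtain g where g: "X \<longlonglongrightarrow> g" using Cauchy_convergent convergent_def by blast
  have gH: "g \<in> H" using H(2) X(1) g by (auto simp: closed_sequential_limits)
  have "(\<lambda>n. q (X n)) \<longlonglongrightarrow> q g"
    unfolding q_def by (intro tendsto_intros g f.tendsto)
  moreover have "(\<lambda>n. i + inverse (real (Suc n))) \<longlonglongrightarrow> i + 0"
    by (intro tendsto_intros LIMSEQ_inverse_real_of_nat)
  ultimately have "q g \<le> i + 0"
    by (rule LIMSEQ_le) (use X(2) less_imp_le in blast)
  then have min: "q g \<le> q x" if "x \<in> H" for x using le[OF that] by simp
  have "g \<bullet> v = f v" if v: "v \<in> H" for v
  proof -
    define b where "b = g \<bullet> v - f v"
    have ge: "0 \<le> 2 * t * b + t\<^sup>2 * (v \<bullet> v)" for t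
    proof -
      have "q g \<le> q (g + t *\<^sub>R v)" using gH v H by (intro min) (simp add: subspace_add subspace_scale)
      then show ?thesis
        by (simp add: q_def b_def f.add f.scaleR inner_add inner_commute algebra_simps power2_eq_square)
    qed
    show ?thesis
    proof (cases "v = 0")
      case False
      then have vv: "0 < v \<bullet> v" by simp
      \<comment> \<open>The quadratic in \<open>t\<close> is smallest at \<open>t = - b / (v \<bullet> v)\<close>.\<close>
      have "0 \<le> - (b\<^sup>2 / (v \<bullet> v))"
        using ge[of "- b / (v \<bullet> v)"] vv by (simp add: field_simps power2_eq_square)
      then have "b = 0" using vv by (simp add: divide_le_0_iff zero_le_mult_iff)
      then show ?thesis by (simp add: b_def)
    qed (simp add: f.zero)
  qed
  then show ?thesis using gH by blast
qed

text \<open>The constant \<open>adjoint\<close> chooses some function with this property; Riesz representation shows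
  that there is one.\<close>

lemma hilbert_adjoint_works:
  fixes f :: "'a::{real_inner, complete_space} \<Rightarrow> 'b::real_inner"
  assumes f: "bounded_linear f"
  shows "x \<bullet> adjoint f y = f x \<bullet> y"
proof -
  have "\<exists>w. \<forall>x. f x \<bullet> y = x \<bullet> w" for y
  proof -
    have "bounded_linear (\<lambda>x. f x \<bullet> y)"
      by (rule bounded_linear_compose[OF bounded_linear_inner_left f])
    from riesz_on_subspace[OF this, of UNIV] show ?thesis by (metis UNIV_I closed_UNIV inner_commute subspace_UNIV)
  qed
  then obtain g where g: "\<forall>x y. f x \<bullet> y = x \<bullet> g y" by metis
  then have "adjoint f = g" by (rule adjoint_unique)
  then show ?thesis using g by simp
qed

lemma hilbert_adjoint_norm_le:
  fixes f :: "'a::{real_inner, complete_space} \<Rightarrow> 'b::real_inner"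
  assumes f: "bounded_linear f"
  shows "norm (adjoint f y) \<le> onorm f * norm y"
proof (cases "adjoint f y = 0")
  case True
  then show ?thesis using onorm_pos_le[OF f] by simp
next
  case False
  let ?s = "adjoint f y"
  have "norm ?s * norm ?s = f ?s \<bullet> y"
    by (simp flip: hilbert_adjoint_works[OF f] power2_norm_eq_inner add: power2_eq_square)
  also have "\<dots> \<le> norm (f ?s) * norm y" by (rule norm_cauchy_schwarz)
  also have "\<dots> \<le> onorm f * norm ?s * norm y" by (intro mult_right_mono onorm[OF f]) simp
  finally show ?thesis using False by (simp add: mult.assoc mult.left_commute)
qed

lemma hilbert_adjoint_bounded_linear:
  fixes f :: "'a::{real_inner, complete_space} \<Rightarrow> 'b::real_inner"
  assumes f: "bounded_linear f"
  shows "bounded_linear (adjoint f)"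
proof (rule bounded_linear_intro[where K = "onorm f"])
  note aw = hilbert_adjoint_works[OF f]
  show "adjoint f (x + y) = adjoint f x + adjoint f y" for x y
    by (subst vector_eq_rdot[symmetric]) (simp add: aw inner_add inner_commute[of "adjoint _ _"])
  show "adjoint f (k *\<^sub>R x) = k *\<^sub>R adjoint f x" for k x
    by (subst vector_eq_rdot[symmetric]) (simp add: aw inner_commute[of "adjoint _ _"])
  show "norm (adjoint f x) \<le> norm x * onorm f" for x
    using hilbert_adjoint_norm_le[OF f, of x] by (simp add: mult.commute)
qed

section \<open>Curves in the zero set of a coercive constraint\<close>

text \<open>The mean value theorem on the segment from \<open>z\<close> to \<open>z + E d\<close>, applied to the component
  of \<open>\<Psi>\<close> along \<open>d\<close>, turns coercivity of the derivative into strong monotonicity.\<close>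

lemma monotone_along_coercive_direction:
  fixes \<Psi> :: "'e::real_normed_vector \<Rightarrow> 'y::real_inner" and \<Psi>' :: "'e \<Rightarrow> 'e \<Rightarrow>\<^sub>L 'y"
    and E :: "'y \<Rightarrow>\<^sub>L 'e"
  assumes S: "convex S" and der: "\<And>z. z \<in> S \<Longrightarrow> (\<Psi> has_derivative blinfun_apply (\<Psi>' z)) (at z)"
    and coer: "\<And>z \<eta>. z \<in> S \<Longrightarrow> m * (norm \<eta>)\<^sup>2 \<le> \<Psi>' z (E \<eta>) \<bullet> \<eta>"
    and z: "z \<in> S" "z + E d \<in> S"
  shows "m * (norm d)\<^sup>2 \<le> (\<Psi> (z + E d) - \<Psi> z) \<bullet> d"
proof -
  have inS: "z + s *\<^sub>R E d \<in> S" if "0 \<le> s" "s \<le> 1" for s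
  proof -
    have "(1 - s) *\<^sub>R z + s *\<^sub>R (z + E d) \<in> S"
      using S z that by (intro convexD) auto
    then show ?thesis by (simp add: algebra_simps)
  qed
  have "\<exists>s\<in>{0<..<1}. \<Psi> (z + 1 *\<^sub>R E d) \<bullet> d - \<Psi> (z + 0 *\<^sub>R E d) \<bullet> d
      = \<Psi>' (z + s *\<^sub>R E d) ((1 - 0) *\<^sub>R E d) \<bullet> d"
  proof (rule mvt_simple)
    fix s :: real assume "0 \<le> s" "s \<le> 1"
    have "((\<lambda>s. z + s *\<^sub>R E d) has_derivative (\<lambda>h. h *\<^sub>R E d)) (at s)"
      by (auto intro!: derivative_eq_intros)
    from has_derivative_compose[OF this der[OF inS[OF \<open>0 \<le> s\<close> \<open>s \<le> 1\<close>]]]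
    have "((\<lambda>s. \<Psi> (z + s *\<^sub>R E d)) has_derivative (\<lambda>h. \<Psi>' (z + s *\<^sub>R E d) (h *\<^sub>R E d))) (at s)" .
    then show "((\<lambda>s. \<Psi> (z + s *\<^sub>R E d) \<bullet> d) has_derivative (\<lambda>h. \<Psi>' (z + s *\<^sub>R E d) (h *\<^sub>R E d) \<bullet> d))
        (at s within {0..1})"
      by (rule has_derivative_at_withinI[OF has_derivative_inner_left])
  qed simp
  then obtain s where "0 < s" "s < 1"
    and "\<Psi> (z + E d) \<bullet> d - \<Psi> z \<bullet> d = \<Psi>' (z + s *\<^sub>R E d) (E d) \<bullet> d" by auto
  with coer[OF inS[of s], of d] show ?thesis by (simp add: inner_diff_left)
qed

text \<open>By continuity of the derivative, coercivity of \<open>\<Psi>' a \<circ> E\<close> persists near \<open>a\<close> with half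
  the constant, since \<open>\<Psi>'\<close> varies by at most \<open>C / (2 (norm E + 1))\<close> on a small ball.\<close>

lemma coercive_near:
  fixes \<Psi>' :: "'e::real_normed_vector \<Rightarrow> 'e \<Rightarrow>\<^sub>L 'y::real_inner" and E :: "'y \<Rightarrow>\<^sub>L 'e"
  assumes V: "open V" "a \<in> V" and cont: "continuous_on V \<Psi>'" and C: "0 < C"
    and coer: "\<And>\<eta>. C * (norm \<eta>)\<^sup>2 \<le> \<Psi>' a (E \<eta>) \<bullet> \<eta>"
  obtains R N where "0 < R" "0 < N" "ball a R \<subseteq> V"
    "\<And>z. z \<in> ball a R \<Longrightarrow> norm (\<Psi>' z) \<le> N"
    "\<And>z \<eta>. z \<in> ball a R \<Longrightarrow> C / 2 * (norm \<eta>)\<^sup>2 \<le> \<Psi>' z (E \<eta>) \<bullet> \<eta>"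
proof -
  define e where "e = C / (2 * (norm E + 1))"
  have E1: "0 < norm E + 1" by (simp add: add_nonneg_pos)
  have e: "0 < e" using C E1 by (simp add: e_def)
  obtain R1 where R1: "0 < R1" "ball a R1 \<subseteq> V" using V by (auto simp: open_contains_ball)
  obtain R2 where R2: "0 < R2" "\<And>z. z \<in> V \<Longrightarrow> dist z a < R2 \<Longrightarrow> dist (\<Psi>' z) (\<Psi>' a) < e"
    using cont V(2) e unfolding continuous_on_iff by metis
  have near: "norm (\<Psi>' z - \<Psi>' a) < e" if "z \<in> ball a (min R1 R2)" for z
    using R1 R2(2)[of z] that by (auto simp: dist_commute dist_norm[symmetric])
  show thesis
  proof (rule that[of "min R1 R2" "norm (\<Psi>' a) + e"])
    show "0 < min R1 R2" using R1 R2 by simp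
    show "0 < norm (\<Psi>' a) + e" using e by (simp add: add_nonneg_pos)
    show "ball a (min R1 R2) \<subseteq> V" using R1(2) by auto
  next
    fix z assume z: "z \<in> ball a (min R1 R2)"
    show "norm (\<Psi>' z) \<le> norm (\<Psi>' a) + e"
      using near[OF z] norm_triangle_ineq2[of "\<Psi>' z" "\<Psi>' a"] by simp
    fix \<eta>
    have "\<bar>(\<Psi>' z - \<Psi>' a) (E \<eta>) \<bullet> \<eta>\<bar> \<le> norm ((\<Psi>' z - \<Psi>' a) (E \<eta>)) * norm \<eta>"
      by (rule Cauchy_Schwarz_ineq2)
    also have "\<dots> \<le> (e * ((norm E + 1) * norm \<eta>)) * norm \<eta>"
    proof (rule mult_right_mono)
      have "norm ((\<Psi>' z - \<Psi>' a) (E \<eta>)) \<le> norm (\<Psi>' z - \<Psi>' a) * norm (E \<eta>)"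
        by (rule norm_blinfun)
      also have "\<dots> \<le> e * ((norm E + 1) * norm \<eta>)"
        using near[OF z] norm_blinfun[of E \<eta>] e by (intro mult_mono) (auto simp: distrib_right intro: add_increasing2)
      finally show "norm ((\<Psi>' z - \<Psi>' a) (E \<eta>)) \<le> e * ((norm E + 1) * norm \<eta>)" .
    qed simp
    also have "\<dots> = C / 2 * (norm \<eta>)\<^sup>2"
      using E1 by (simp add: e_def field_simps power2_eq_square)
    finally show "C / 2 * (norm \<eta>)\<^sup>2 \<le> \<Psi>' z (E \<eta>) \<bullet> \<eta>"
      using coer[of \<eta>] unfolding blinfun.diff_left inner_diff_left by linarith
  qed
qed

text \<open>A one-parameter implicit function theorem, with coercivity in place of an abstract inverse.
  For each small \<open>t\<close>, the map \<open>d \<mapsto> \<Psi> (a + t w + E d)\<close> is strongly monotone and Lipschitz on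
  a fixed ball, so it has a zero \<open>\<delta> t\<close> there. Strong monotonicity, uniform in \<open>t\<close>, also makes
  \<open>\<delta>\<close> Lipschitz. The derivative must be the solution \<open>\<eta> t\<close> of the linearised equation
  \<open>\<Psi>' (w + E (\<eta> t)) = 0\<close>, which exists by Lax--Milgram; coercivity turns the linearisation
  error into the differentiability of \<open>\<delta>\<close> and the continuity of \<open>\<Psi>'\<close> into that of \<open>\<eta>\<close>.\<close>

lemma implicit_curve:
  fixes \<Psi> :: "'e::real_normed_vector \<Rightarrow> 'y::{real_inner, complete_space}"
    and \<Psi>' :: "'e \<Rightarrow> 'e \<Rightarrow>\<^sub>L 'y" and E :: "'y \<Rightarrow>\<^sub>L 'e"
  assumes V: "open V" "a \<in> V"
    and der: "\<And>z. z \<in> V \<Longrightarrow> (\<Psi> has_derivative blinfun_apply (\<Psi>' z)) (at z)"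
    and cont: "continuous_on V \<Psi>'"
    and C: "0 < C" and coer: "\<And>\<eta>. C * (norm \<eta>)\<^sup>2 \<le> \<Psi>' a (E \<eta>) \<bullet> \<eta>"
    and zero: "\<Psi> a = 0" and w: "\<Psi>' a w = 0"
  obtains \<epsilon> \<delta> \<eta> where "0 < \<epsilon>" "\<delta> 0 = 0" "\<eta> 0 = 0" "continuous_on {-\<epsilon><..<\<epsilon>} \<eta>"
    "\<And>t. t \<in> {-\<epsilon><..<\<epsilon>} \<Longrightarrow> a + t *\<^sub>R w + E (\<delta> t) \<in> V \<and> \<Psi> (a + t *\<^sub>R w + E (\<delta> t)) = 0 \<and>
      (\<delta> has_vector_derivative \<eta> t) (at t)"
proof -
  obtain R N where R: "0 < R" and N: "0 < N" and RV: "ball a R \<subseteq> V"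
    and bnd: "\<And>z. z \<in> ball a R \<Longrightarrow> norm (\<Psi>' z) \<le> N"
    and coerR: "\<And>z \<eta>. z \<in> ball a R \<Longrightarrow> C / 2 * (norm \<eta>)\<^sup>2 \<le> \<Psi>' z (E \<eta>) \<bullet> \<eta>"
    using coercive_near[OF V cont C coer] by metis
  define m where "m = C / 2"
  have m: "0 < m" using C by (simp add: m_def)
  have derR: "(\<Psi> has_derivative blinfun_apply (\<Psi>' z)) (at z)" if "z \<in> ball a R" for z
    using der RV that by blast
  note coerm = coerR[folded m_def]
  have mono: "m * (norm d)\<^sup>2 \<le> (\<Psi> (z + E d) - \<Psi> z) \<bullet> d"
    if "z \<in> ball a R" "z + E d \<in> ball a R" for z d
    using monotone_along_coercive_direction[OF convex_ball derR coerm that] .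
  have lip: "norm (\<Psi> y - \<Psi> z) \<le> N * norm (y - z)" if "y \<in> ball a R" "z \<in> ball a R" for y z
  proof (rule differentiable_bound[OF convex_ball _ _ that])
    show "(\<Psi> has_derivative blinfun_apply (\<Psi>' x)) (at x within ball a R)" if "x \<in> ball a R" for x
      using derR[OF that] by (rule has_derivative_at_withinI)
    show "onorm (blinfun_apply (\<Psi>' x)) \<le> N" if "x \<in> ball a R" for x
      using bnd[OF that] by (simp add: norm_blinfun.rep_eq)
  qed
  define Z where "Z t d = a + t *\<^sub>R w + E d" for t d
  define r where "r = R / (2 * (norm E + 1))"
  \<comment> \<open>The first bound keeps the points in the ball of radius \<open>R\<close>, the second one makes the
    residual at \<open>d = 0\<close> small enough for \<open>strongly_monotone_zero\<close>.\<close>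
  define \<epsilon> where "\<epsilon> = min (R / (2 * (norm w + 1))) (m * r / (2 * (N * (norm w + 1))))"
  have E1: "0 < norm E + 1" and w1: "0 < norm w + 1" by (simp_all add: add_nonneg_pos)
  have r: "0 < r" using R E1 by (simp add: r_def)
  have \<epsilon>: "0 < \<epsilon>" using R m r N w1 by (simp add: \<epsilon>_def)
  have tw: "\<bar>t\<bar> * norm w < R / 2" "N * (\<bar>t\<bar> * norm w) \<le> m * r / 2" if "\<bar>t\<bar> < \<epsilon>" for t
  proof -
    have *: "\<bar>t\<bar> * norm w \<le> \<bar>t\<bar> * (norm w + 1)" by (simp add: algebra_simps)
    have "\<bar>t\<bar> < R / (2 * (norm w + 1))" "\<bar>t\<bar> < m * r / (2 * (N * (norm w + 1)))"
      using that by (auto simp: \<epsilon>_def)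
    then have "\<bar>t\<bar> * (norm w + 1) < R / 2" "N * (\<bar>t\<bar> * (norm w + 1)) < m * r / 2"
      using w1 N by (simp_all add: pos_less_divide_eq mult_ac)
    moreover have "N * (\<bar>t\<bar> * norm w) \<le> N * (\<bar>t\<bar> * (norm w + 1))"
      using * N by (intro mult_left_mono) auto
    ultimately show "\<bar>t\<bar> * norm w < R / 2" "N * (\<bar>t\<bar> * norm w) \<le> m * r / 2"
      using * by linarith+
  qed
  have ZR: "Z t d \<in> ball a R" if "\<bar>t\<bar> < \<epsilon>" "norm d \<le> r" for t d
  proof -
    have "norm (E d) \<le> norm E * norm d" by (rule norm_blinfun)
    also have "\<dots> \<le> (norm E + 1) * r" using that E1 by (intro mult_mono) auto
    also have "\<dots> = R / 2"
      unfolding r_def using less_imp_neq[OF E1] by (simp add: divide_simps del: distrib_left_numeral)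
    finally have "norm (t *\<^sub>R w + E d) < R"
      using norm_triangle_ineq[of "t *\<^sub>R w" "E d"] tw(1)[OF that(1)] by simp
    moreover have "Z t d - a = t *\<^sub>R w + E d" by (simp add: Z_def)
    ultimately show ?thesis by (simp add: dist_norm norm_minus_commute[of a "Z t d"])
  qed
  have monoZ: "m * (norm (d - d'))\<^sup>2 \<le> (\<Psi> (Z t d) - \<Psi> (Z t d')) \<bullet> (d - d')"
    if "\<bar>t\<bar> < \<epsilon>" "norm d \<le> r" "norm d' \<le> r" for t d d'
  proof -
    have "Z t d' + E (d - d') = Z t d" by (simp add: Z_def blinfun.diff_right)
    then show ?thesis using mono[of "Z t d'" "d - d'"] ZR that by simp
  qed
  have "\<exists>d. norm d \<le> r \<and> \<Psi> (Z t d) = 0" if t: "\<bar>t\<bar> < \<epsilon>" for t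
  proof -
    have "\<exists>d\<in>cball 0 r. \<Psi> (Z t d) = 0"
    proof (rule strongly_monotone_zero[where m = m and N = "max m (N * norm E)"])
      fix u v :: 'y assume u: "u \<in> cball 0 r" and v: "v \<in> cball 0 r"
      then show "m * (norm (u - v))\<^sup>2 \<le> (\<Psi> (Z t u) - \<Psi> (Z t v)) \<bullet> (u - v)"
        using monoZ t by simp
      have "norm (\<Psi> (Z t u) - \<Psi> (Z t v)) \<le> N * norm (E (u - v))"
        using lip[of "Z t u" "Z t v"] ZR t u v by (simp add: Z_def blinfun.diff_right)
      also have "\<dots> \<le> N * (norm E * norm (u - v))"
        using N norm_blinfun[of E "u - v"] by (intro mult_left_mono) auto
      also have "\<dots> \<le> max m (N * norm E) * norm (u - v)"
        by (simp add: mult.assoc[symmetric] mult_right_mono)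
      finally show "norm (\<Psi> (Z t u) - \<Psi> (Z t v)) \<le> max m (N * norm E) * norm (u - v)" .
    next
      have "norm (\<Psi> (Z t 0) - \<Psi> a) \<le> N * norm (t *\<^sub>R w)"
        using lip[of "Z t 0" a] ZR[OF t, of 0] r R by (simp add: Z_def)
      then show "norm (\<Psi> (Z t 0)) \<le> m * r / 2" using tw(2)[OF t] zero by simp
    qed (use m r in auto)
    then show ?thesis by auto
  qed
  then obtain \<delta> where \<delta>: "\<And>t. \<bar>t\<bar> < \<epsilon> \<Longrightarrow> norm (\<delta> t) \<le> r" "\<And>t. \<bar>t\<bar> < \<epsilon> \<Longrightarrow> \<Psi> (Z t (\<delta> t)) = 0"
    by metis
  have \<delta>0: "\<delta> 0 = 0"
    using monoZ[of 0 "\<delta> 0" 0] \<delta>[of 0] \<epsilon> r m zero by (simp add: Z_def mult_le_0_iff)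
  define z where "z t = Z t (\<delta> t)" for t
  have zR: "z t \<in> ball a R" if "\<bar>t\<bar> < \<epsilon>" for t
    unfolding z_def using ZR \<delta>(1) that by blast
  have zdiff: "z t - z s = (t - s) *\<^sub>R w + E (\<delta> t - \<delta> s)" for s t
    by (simp add: z_def Z_def blinfun.diff_right algebra_simps)
  define \<Lambda> where "\<Lambda> = N * norm w / m"
  have \<delta>lip: "norm (\<delta> t - \<delta> s) \<le> \<Lambda> * \<bar>t - s\<bar>" if t: "\<bar>t\<bar> < \<epsilon>" and s: "\<bar>s\<bar> < \<epsilon>" for t s
  proof -
    have "m * norm (\<delta> t - \<delta> s) \<le> norm (\<Psi> (Z s (\<delta> t)) - \<Psi> (Z t (\<delta> t)))"
      using coercive_cancel[OF monoZ[of s "\<delta> t" "\<delta> s"]] \<delta> t s by simp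
    also have "\<dots> \<le> N * norm ((s - t) *\<^sub>R w)"
    proof -
      have "Z s (\<delta> t) - Z t (\<delta> t) = (s - t) *\<^sub>R w" by (simp add: Z_def algebra_simps)
      then show ?thesis using lip[OF ZR[OF s \<delta>(1)[OF t]] ZR[OF t \<delta>(1)[OF t]]] by simp
    qed
    also have "\<dots> = m * (\<Lambda> * \<bar>t - s\<bar>)" using m by (simp add: \<Lambda>_def abs_minus_commute)
    finally show ?thesis using m by simp
  qed
  define \<kappa> where "\<kappa> = norm w + norm E * \<Lambda>"
  have \<Lambda>: "0 \<le> \<Lambda>" using N m by (simp add: \<Lambda>_def)
  have \<kappa>: "0 \<le> \<kappa>" using \<Lambda> by (simp add: \<kappa>_def)
  have zlip: "norm (z t - z s) \<le> \<kappa> * \<bar>t - s\<bar>" if "\<bar>t\<bar> < \<epsilon>" "\<bar>s\<bar> < \<epsilon>" for t s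
  proof -
    have "norm (z t - z s) \<le> \<bar>t - s\<bar> * norm w + norm (E (\<delta> t - \<delta> s))"
      unfolding zdiff using norm_triangle_ineq[of "(t - s) *\<^sub>R w" "E (\<delta> t - \<delta> s)"] by simp
    also have "norm (E (\<delta> t - \<delta> s)) \<le> norm E * (\<Lambda> * \<bar>t - s\<bar>)"
      using norm_blinfun[of E "\<delta> t - \<delta> s"] \<delta>lip[OF that]
      by (meson mult_left_mono norm_ge_zero order.trans)
    finally show ?thesis by (simp add: \<kappa>_def algebra_simps)
  qed
  have "\<exists>h. \<Psi>' (z t) (w + E h) = 0" if t: "\<bar>t\<bar> < \<epsilon>" for t
  proof -
    have "bij (\<lambda>h. \<Psi>' (z t) (E h))"
      by (rule lax_milgram(1)[OF _ m coerm[OF zR[OF t]]])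
        (intro bounded_linear_compose[OF blinfun.bounded_linear_right blinfun.bounded_linear_right])
    then obtain h where "\<Psi>' (z t) (E h) = - \<Psi>' (z t) w" by (metis bij_pointE)
    then show ?thesis by (intro exI[of _ h]) (simp add: blinfun.add_right)
  qed
  then obtain \<eta> where \<eta>: "\<And>t. \<bar>t\<bar> < \<epsilon> \<Longrightarrow> \<Psi>' (z t) (w + E (\<eta> t)) = 0" by metis
  have z0: "z 0 = a" by (simp add: z_def Z_def \<delta>0 blinfun.zero_right)
  have "\<Psi>' (z 0) (E (\<eta> 0)) = 0" using \<eta>[of 0] \<epsilon> w by (simp add: z0 blinfun.add_right)
  then have \<eta>0: "\<eta> 0 = 0"
    using coerm[OF zR[of 0], of "\<eta> 0"] \<epsilon> m by (simp add: mult_le_0_iff)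
  have deriv: "(\<delta> has_vector_derivative \<eta> t) (at t)" if t: "\<bar>t\<bar> < \<epsilon>" for t
    unfolding has_vector_derivative_def has_derivative_at_alt
  proof (intro conjI allI impI)
    show "bounded_linear (\<lambda>x. x *\<^sub>R \<eta> t)" by (rule bounded_linear_scaleR_left)
    fix e :: real assume e: "0 < e"
    define e' where "e' = m * e / (\<kappa> + 1)"
    have e': "0 < e'" using m e \<kappa> by (simp add: e'_def)
    obtain d where d: "0 < d" and dz: "\<And>y. norm (y - z t) < d \<Longrightarrow>
        norm (\<Psi> y - \<Psi> (z t) - \<Psi>' (z t) (y - z t)) \<le> e' * norm (y - z t)"
      using derR[OF zR[OF t]] e' unfolding has_derivative_at_alt by blast
    define \<tau> where "\<tau> = min (\<epsilon> - \<bar>t\<bar>) (d / (\<kappa> + 1))"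
    have \<tau>: "0 < \<tau>" using t d \<kappa> by (simp add: \<tau>_def)
    have "norm (\<delta> s - \<delta> t - (s - t) *\<^sub>R \<eta> t) \<le> e * norm (s - t)" if s: "norm (s - t) < \<tau>" for s
    proof -
      have sb: "\<bar>s\<bar> < \<epsilon>" and sd: "\<bar>s - t\<bar> < d / (\<kappa> + 1)" using s by (auto simp: \<tau>_def)
      \<comment> \<open>As \<open>\<Psi>\<close> vanishes along \<open>z\<close>, the linearisation error of \<open>\<Psi>\<close> is, up to its sign,
        \<open>\<Psi>' (z t) (E h)\<close>.\<close>
      define h where "h = \<delta> s - \<delta> t - (s - t) *\<^sub>R \<eta> t"
      have zl: "norm (z s - z t) \<le> (\<kappa> + 1) * \<bar>s - t\<bar>"
        using zlip[OF sb t] by (simp add: algebra_simps)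
      also have "\<dots> < d" using sd \<kappa> by (simp add: pos_less_divide_eq mult.commute)
      finally have "norm (\<Psi> (z s) - \<Psi> (z t) - \<Psi>' (z t) (z s - z t)) \<le> e' * norm (z s - z t)"
        by (rule dz)
      moreover have "\<Psi> (z s) = 0" "\<Psi> (z t) = 0" using \<delta>(2) sb t by (simp_all add: z_def)
      moreover have "\<Psi>' (z t) (z s - z t) = \<Psi>' (z t) (E h)"
      proof -
        have "z s - z t = (s - t) *\<^sub>R (w + E (\<eta> t)) + E h"
          by (simp add: zdiff h_def blinfun.bilinear_simps algebra_simps)
        then show ?thesis using \<eta>[OF t] by (simp add: blinfun.add_right[of "\<Psi>' _"] blinfun.scaleR_right)
      qed
      ultimately have "norm (\<Psi>' (z t) (E h)) \<le> e' * norm (z s - z t)" by simp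
      also have "\<dots> \<le> e' * ((\<kappa> + 1) * \<bar>s - t\<bar>)" using zl e' by (intro mult_left_mono) auto
      also have "\<dots> = m * (e * \<bar>s - t\<bar>)" using \<kappa> by (simp add: e'_def)
      finally have "m * norm h \<le> m * (e * \<bar>s - t\<bar>)"
        using coercive_cancel[OF coerm[OF zR[OF t], of h]] by linarith
      then show ?thesis using m by (simp add: h_def)
    qed
    then show "\<exists>d>0. \<forall>y. norm (y - t) < d \<longrightarrow> norm (\<delta> y - \<delta> t - (y - t) *\<^sub>R \<eta> t) \<le> e * norm (y - t)"
      using \<tau> by blast
  qed
  have contz: "continuous_on {-\<epsilon><..<\<epsilon>} (\<lambda>t. \<Psi>' (z t))"
  proof (rule continuous_on_compose2[OF cont])
    show "continuous_on {-\<epsilon><..<\<epsilon>} z"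
    proof (rule lipschitz_on_continuous_on)
      show "\<kappa>-lipschitz_on {-\<epsilon><..<\<epsilon>} z"
        using zlip \<kappa> by (intro lipschitz_onI) (auto simp: dist_norm)
    qed
    show "z ` {-\<epsilon><..<\<epsilon>} \<subseteq> V" using zR RV by (auto simp: subset_iff)
  qed
  have "continuous_on {-\<epsilon><..<\<epsilon>} \<eta>"
    unfolding continuous_on_def
  proof
    fix t assume "t \<in> {-\<epsilon><..<\<epsilon>}"
    then have t: "\<bar>t\<bar> < \<epsilon>" by auto
    let ?F = "at t within {-\<epsilon><..<\<epsilon>}"
    have lim: "((\<lambda>s. norm (\<Psi>' (z s) - \<Psi>' (z t)) * norm (w + E (\<eta> t)) / m) \<longlongrightarrow> 0) ?F"
    proof -
      have "((\<lambda>s. \<Psi>' (z s)) \<longlongrightarrow> \<Psi>' (z t)) ?F"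
        using contz \<open>t \<in> _\<close> unfolding continuous_on_def by blast
      then show ?thesis
        by (intro tendsto_divide_zero tendsto_mult_left_zero tendsto_norm_zero LIM_zero)
    qed
    have "\<forall>\<^sub>F s in ?F. norm (\<eta> s - \<eta> t) \<le> norm (\<Psi>' (z s) - \<Psi>' (z t)) * norm (w + E (\<eta> t)) / m"
      unfolding eventually_at_filter
    proof (intro always_eventually allI impI)
      fix s assume "s \<in> {-\<epsilon><..<\<epsilon>}"
      then have s: "\<bar>s\<bar> < \<epsilon>" by auto
      \<comment> \<open>Subtract the linearised equations at \<open>s\<close> and \<open>t\<close>.\<close>
      have "\<Psi>' (z s) (E (\<eta> s - \<eta> t)) = - ((\<Psi>' (z s) - \<Psi>' (z t)) (w + E (\<eta> t)))"
      proof -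
        have "E (\<eta> s - \<eta> t) = (w + E (\<eta> s)) - (w + E (\<eta> t))" by (simp add: blinfun.diff_right)
        then show ?thesis using \<eta>[OF s] \<eta>[OF t]
          by (simp only: blinfun.diff_right blinfun.diff_left) simp
      qed
      then have "m * norm (\<eta> s - \<eta> t) \<le> norm ((\<Psi>' (z s) - \<Psi>' (z t)) (w + E (\<eta> t)))"
        using coercive_cancel[OF coerm[OF zR[OF s], of "\<eta> s - \<eta> t"]] by simp
      also have "\<dots> \<le> norm (\<Psi>' (z s) - \<Psi>' (z t)) * norm (w + E (\<eta> t))" by (rule norm_blinfun)
      finally show "norm (\<eta> s - \<eta> t) \<le> norm (\<Psi>' (z s) - \<Psi>' (z t)) * norm (w + E (\<eta> t)) / m"
        using m by (simp add: field_simps)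
    qed
    from Lim_null_comparison[OF this lim] show "(\<eta> \<longlongrightarrow> \<eta> t) ?F" by (rule LIM_zero_cancel)
  qed
  then show thesis
  proof (rule that[of \<epsilon> \<delta> \<eta>, OF \<epsilon> \<delta>0 \<eta>0])
    fix t assume "t \<in> {-\<epsilon><..<\<epsilon>}"
    then have t: "\<bar>t\<bar> < \<epsilon>" by auto
    show "a + t *\<^sub>R w + E (\<delta> t) \<in> V \<and> \<Psi> (a + t *\<^sub>R w + E (\<delta> t)) = 0 \<and>
        (\<delta> has_vector_derivative \<eta> t) (at t)"
      using zR[OF t] RV \<delta>(2)[OF t] deriv[OF t] by (auto simp: z_def Z_def)
  qed
qed

section \<open>The tangent space of the constrained set\<close>

lemma tangent_space_mono: "S \<subseteq> T \<Longrightarrow> tangent_space S x \<subseteq> tangent_space T x"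
  unfolding tangent_space_def by blast

text \<open>The difference quotients at \<open>0\<close> of the image of a tangent curve lie in \<open>H\<close>, which is closed.
  Applied to a straightening chart this shows that the chart maps tangent vectors into the model
  subspace; applied to the constraint, with \<open>H = {0}\<close>, that \<open>B\<close> kills the vectors tangent to
  the constrained set.\<close>

lemma derivative_tangent_mem_subspace:
  fixes \<phi> :: "'a::real_normed_vector \<Rightarrow> 'b::real_normed_vector"
  assumes v: "v \<in> tangent_space M x" and U: "open U" "x \<in> U"
    and \<phi>: "(\<phi> has_derivative D) (at x)"
    and H: "subspace H" "closed H" "\<phi> ` (M \<inter> U) \<subseteq> H"
  shows "D v \<in> H"
proof -
  obtain \<gamma> \<gamma>' \<epsilon> where \<epsilon>: "(0::real) < \<epsilon>" and \<gamma>0: "\<gamma> 0 = x" "\<gamma>' 0 = v"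
    and \<gamma>: "\<And>t. t \<in> {-\<epsilon><..<\<epsilon>} \<Longrightarrow> \<gamma> t \<in> M \<and> (\<gamma> has_vector_derivative \<gamma>' t) (at t)"
    using v unfolding tangent_space_def by blast
  interpret D: bounded_linear D using \<phi> by (rule has_derivative_bounded_linear)
  have d\<gamma>: "(\<gamma> has_derivative (\<lambda>h. h *\<^sub>R v)) (at 0)"
    using \<gamma>[of 0] \<epsilon> \<gamma>0 by (simp add: has_vector_derivative_def)
  have comp: "((\<lambda>t. \<phi> (\<gamma> t)) has_derivative (\<lambda>h. h *\<^sub>R D v)) (at 0)"
    using has_derivative_compose[OF d\<gamma>, of \<phi> D] \<phi> by (simp add: \<gamma>0 D.scaleR)
  have "isCont \<gamma> 0" using d\<gamma> by (rule has_derivative_continuous)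
  then have "\<forall>\<^sub>F t in at 0. \<gamma> t \<in> U"
    using U \<gamma>0 by (simp add: isCont_def topological_tendstoD)
  then obtain \<epsilon>' where \<epsilon>': "0 < \<epsilon>'" "\<And>t. t \<noteq> 0 \<Longrightarrow> \<bar>t\<bar> < \<epsilon>' \<Longrightarrow> \<gamma> t \<in> U"
    by (auto simp: eventually_at)
  have "D v \<in> closure H"
    unfolding closure_approachable
  proof (intro allI impI)
    fix e :: real assume e: "0 < e"
    then obtain d where d: "0 < d"
      "\<And>t. norm (t - 0) < d \<Longrightarrow> norm (\<phi> (\<gamma> t) - \<phi> (\<gamma> 0) - (t - 0) *\<^sub>R D v) \<le> e / 2 * norm (t - 0)"
      using comp unfolding has_derivative_at_alt by (meson half_gt_zero)
    define t where "t = min (min (\<epsilon> / 2) (\<epsilon>' / 2)) (d / 2)"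
    have t: "0 < t" "t < \<epsilon>" "t < \<epsilon>'" "t < d" using \<epsilon> \<epsilon>' d by (auto simp: t_def)
    define y where "y = (1 / t) *\<^sub>R (\<phi> (\<gamma> t) - \<phi> x)"
    have "\<phi> (\<gamma> t) \<in> H" "\<phi> x \<in> H"
      using \<gamma>[of t] \<gamma>[of 0] \<epsilon>'(2)[of t] t \<epsilon> U H(3) \<gamma>0 by auto
    then have yH: "y \<in> H" unfolding y_def using H(1) by (intro subspace_scale subspace_diff)
    have "y - D v = (1 / t) *\<^sub>R (\<phi> (\<gamma> t) - \<phi> x - t *\<^sub>R D v)"
      using t by (simp add: y_def scaleR_diff_right)
    then have "norm (y - D v) = norm (\<phi> (\<gamma> t) - \<phi> x - t *\<^sub>R D v) / t" using t by simp
    also have "\<dots> \<le> e / 2" using d(2)[of t] t \<gamma>0 by (simp add: pos_divide_le_eq)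
    finally have "dist y (D v) < e" using e by (simp add: dist_norm)
    then show "\<exists>y\<in>H. dist y (D v) < e" using yH by blast
  qed
  then show ?thesis using H(2) by simp
qed

lemma C2_onE:
  assumes "C2_on f U" "open U"
  obtains f' where "\<And>x. x \<in> U \<Longrightarrow> (f has_derivative blinfun_apply (f' x)) (at x)" "continuous_on U f'"
proof -
  obtain f' f'' where f': "\<And>x. x \<in> U \<Longrightarrow> (f has_derivative blinfun_apply (f' x)) (at x)"
    and f'': "\<And>x. x \<in> U \<Longrightarrow> (f' has_derivative blinfun_apply (f'' x)) (at x)"
    using assms(1) unfolding C2_on_def by metis
  have "continuous_on U f'"
    using has_derivative_continuous[OF f''] by (simp add: continuous_at_imp_continuous_on)
  then show thesis using that f' by blast
qed

text \<open>The inclusion from right to left is the substantial one: every \<open>v\<close> tangent to \<open>M\<close> with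
  \<open>B v = 0\<close> has to be the velocity of a curve in \<open>M\<close> that satisfies the constraint. In a chart
  \<open>\<phi>\<close> with inverse \<open>\<psi>\<close>, move in the direction \<open>w = \<phi>' x v\<close> and correct the constraint
  along \<open>E = \<phi>' x \<circ> P x \<circ> B\<^sup>*\<close>, which takes its values in the model subspace \<open>H\<close>, so that
  the corrected curve stays in \<open>M\<close>. The derivative of the constraint along \<open>E\<close> is precisely
  \<open>L_op B P x\<close>, whose coercivity is what \<open>implicit_curve\<close> asks for.\<close>

lemma tangent_space_constrained_set:
  fixes M :: "'e::{real_inner, complete_space} set"
    and B :: "'e \<Rightarrow>\<^sub>L 'y::{real_inner, complete_space}"
  assumes M: "C2_submanifold M" and x: "x \<in> constrained_set M B c"
    and P: "range (blinfun_apply (P x)) \<subseteq> tangent_space M x"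
    and C: "0 < C" and coer: "\<And>\<delta>. C * (norm \<delta>)\<^sup>2 \<le> L_op B P x \<delta> \<bullet> \<delta>"
  shows "tangent_space (constrained_set M B c) x = tangent_space M x \<inter> {v. blinfun_apply B v = 0}"
proof (intro equalityI subsetI IntI)
  fix v assume v: "v \<in> tangent_space (constrained_set M B c) x"
  show "v \<in> tangent_space M x"
    using v tangent_space_mono[of "constrained_set M B c" M x] by (auto simp: constrained_set_def)
  \<comment> \<open>The map \<open>B - c\<close> sends the constrained set into the zero subspace.\<close>
  have "blinfun_apply B v \<in> {0}"
  proof (rule derivative_tangent_mem_subspace[OF v open_UNIV])
    show "((\<lambda>x. blinfun_apply B x - c) has_derivative blinfun_apply B) (at x)"
      by (auto intro!: derivative_eq_intros)
  qed (auto simp: constrained_set_def)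
  then show "v \<in> {v. blinfun_apply B v = 0}" by simp
next
  fix v assume "v \<in> tangent_space M x \<inter> {v. blinfun_apply B v = 0}"
  then have v: "v \<in> tangent_space M x" and Bv: "blinfun_apply B v = 0" by auto
  have xM: "x \<in> M" and Bx: "blinfun_apply B x = c" using x by (auto simp: constrained_set_def)
  obtain U V and \<phi> \<psi> :: "'e \<Rightarrow> 'e" and H where U: "open U" "x \<in> U" and V: "open V"
    and hom: "homeomorphism U V \<phi> \<psi>" and C2: "C2_on \<phi> U" "C2_on \<psi> V"
    and H: "subspace H" "closed H" and img: "\<phi> ` (M \<inter> U) = H \<inter> V"
    using M xM unfolding C2_submanifold_def by meson
  obtain \<phi>' where \<phi>': "\<And>x. x \<in> U \<Longrightarrow> (\<phi> has_derivative blinfun_apply (\<phi>' x)) (at x)"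
    using C2_onE[OF C2(1) U(1)] by metis
  obtain \<psi>' where \<psi>': "\<And>x. x \<in> V \<Longrightarrow> (\<psi> has_derivative blinfun_apply (\<psi>' x)) (at x)"
    and \<psi>'c: "continuous_on V \<psi>'"
    using C2_onE[OF C2(2) V] by metis
  define a where "a = \<phi> x"
  have \<psi>\<phi>: "\<psi> (\<phi> y) = y" if "y \<in> U" for y using hom that by (simp add: homeomorphism_def)
  have aHV: "a \<in> H" "a \<in> V" using img xM U(2) by (auto simp: a_def)
  have inv: "\<psi>' a (\<phi>' x u) = u" for u
  proof -
    have "((\<lambda>y. \<psi> (\<phi> y)) has_derivative (\<lambda>u. \<psi>' a (\<phi>' x u))) (at x)"
      using has_derivative_compose[OF \<phi>'[OF U(2)], of \<psi> "blinfun_apply (\<psi>' a)"] \<psi>'[OF aHV(2)]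
      by (simp add: a_def)
    then have "((\<lambda>y. y) has_derivative (\<lambda>u. \<psi>' a (\<phi>' x u))) (at x)"
      by (rule has_derivative_transform_within_open[OF _ U]) (simp add: \<psi>\<phi>)
    from has_derivative_unique[OF this has_derivative_ident] show ?thesis by metis
  qed
  have \<phi>'H: "\<phi>' x u \<in> H" if "u \<in> tangent_space M x" for u
    using derivative_tangent_mem_subspace[OF that U \<phi>'[OF U(2)] H] img by blast
  define w where "w = \<phi>' x v"
  define Bs where "Bs = Blinfun (adjoint (blinfun_apply B))"
  have Bs: "blinfun_apply Bs = adjoint (blinfun_apply B)"
    unfolding Bs_def
    by (rule bounded_linear_Blinfun_apply[OF hilbert_adjoint_bounded_linear[OF blinfun.bounded_linear_right]])
  define E where "E = \<phi>' x o\<^sub>L P x o\<^sub>L Bs"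
  have EH: "E d \<in> H" for d using P \<phi>'H by (auto simp: E_def)
  define \<Psi> where "\<Psi> z = blinfun_apply B (\<psi> z) - c" for z
  define \<Psi>' where "\<Psi>' z = B o\<^sub>L \<psi>' z" for z
  obtain \<epsilon> \<delta> \<eta> where \<epsilon>: "0 < \<epsilon>" and \<delta>0: "\<delta> 0 = 0" and \<eta>0: "\<eta> 0 = 0"
    and \<eta>c: "continuous_on {-\<epsilon><..<\<epsilon>} \<eta>"
    and curve: "\<And>t. t \<in> {-\<epsilon><..<\<epsilon>} \<Longrightarrow> a + t *\<^sub>R w + E (\<delta> t) \<in> V \<and>
      \<Psi> (a + t *\<^sub>R w + E (\<delta> t)) = 0 \<and> (\<delta> has_vector_derivative \<eta> t) (at t)"
  proof (rule implicit_curve)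
    show "open V" "a \<in> V" "0 < C" by fact+
    show "(\<Psi> has_derivative blinfun_apply (\<Psi>' z)) (at z)" if "z \<in> V" for z
      unfolding \<Psi>_def \<Psi>'_def using \<psi>'[OF that] by (auto intro!: derivative_eq_intros)
    show "continuous_on V \<Psi>'"
      unfolding \<Psi>'_def
      by (rule bounded_linear.continuous_on[OF bounded_bilinear.bounded_linear_right[OF bounded_bilinear_blinfun_compose] \<psi>'c])
    show "C * (norm d)\<^sup>2 \<le> \<Psi>' a (E d) \<bullet> d" for d
      using coer[of d] by (simp add: \<Psi>'_def E_def Bs inv L_op_def)
    show "\<Psi> a = 0" using U(2) by (simp add: \<Psi>_def a_def \<psi>\<phi> Bx)
    show "\<Psi>' a w = 0" by (simp add: \<Psi>'_def w_def inv Bv)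
  qed (rule that, blast+)
  define z where "z t = a + t *\<^sub>R w + E (\<delta> t)" for t
  have z0: "z 0 = a" by (simp add: z_def \<delta>0 blinfun.zero_right)
  have zd: "(z has_vector_derivative w + E (\<eta> t)) (at t)" if "t \<in> {-\<epsilon><..<\<epsilon>}" for t
  proof -
    have "(\<delta> has_vector_derivative \<eta> t) (at t)" using curve that by blast
    then have "((\<lambda>t. E (\<delta> t)) has_vector_derivative E (\<eta> t)) (at t)"
      by (rule bounded_linear.has_vector_derivative[OF blinfun.bounded_linear_right])
    then show ?thesis unfolding z_def by (auto intro!: derivative_eq_intros)
  qed
  have zc: "continuous_on {-\<epsilon><..<\<epsilon>} z"
    using zd has_vector_derivative_continuous by (blast intro!: continuous_at_imp_continuous_on)
  have zV: "z t \<in> V" and z0': "\<Psi> (z t) = 0" if "t \<in> {-\<epsilon><..<\<epsilon>}" for t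
    using curve that by (auto simp: z_def)
  have zH: "z t \<in> H" for t
    unfolding z_def w_def using H(1) aHV(1) EH \<phi>'H[OF v] by (intro subspace_add subspace_scale)
  show "v \<in> tangent_space (constrained_set M B c) x"
    unfolding tangent_space_def mem_Collect_eq
  proof (intro exI conjI ballI)
    show "0 < \<epsilon>" by fact
    show "(\<lambda>t. \<psi> (z t)) 0 = x" using U(2) by (simp add: z0 a_def \<psi>\<phi>)
    show "(\<lambda>t. \<psi>' (z t) (w + E (\<eta> t))) 0 = v"
      by (simp add: z0 \<eta>0 blinfun.zero_right w_def inv)
    show "continuous_on {-\<epsilon><..<\<epsilon>} (\<lambda>t. \<psi>' (z t) (w + E (\<eta> t)))"
    proof (rule bounded_bilinear.continuous_on[OF bounded_bilinear_blinfun_apply])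
      show "continuous_on {-\<epsilon><..<\<epsilon>} (\<lambda>t. \<psi>' (z t))"
        by (rule continuous_on_compose2[OF \<psi>'c zc]) (use zV in auto)
      show "continuous_on {-\<epsilon><..<\<epsilon>} (\<lambda>t. w + E (\<eta> t))"
        by (intro continuous_intros \<eta>c)
    qed
  next
    fix t assume t: "t \<in> {-\<epsilon><..<\<epsilon>}"
    have "z t \<in> \<phi> ` (M \<inter> U)" using img zH zV[OF t] by blast
    then have "\<psi> (z t) \<in> M" by (auto simp: \<psi>\<phi>)
    then show "\<psi> (z t) \<in> constrained_set M B c"
      using z0'[OF t] by (simp add: constrained_set_def \<Psi>_def)
    show "((\<lambda>t. \<psi> (z t)) has_vector_derivative \<psi>' (z t) (w + E (\<eta> t))) (at t)"
      using has_derivative_compose[OF zd[OF t, unfolded has_vector_derivative_def] \<psi>'[OF zV[OF t]]]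
      by (simp add: has_vector_derivative_def blinfun.scaleR_right)
  qed
qed

section \<open>The oblique projection and the gradient estimates\<close>

lemma bounded_linear_L_op:
  fixes B :: "'e::{real_inner, complete_space} \<Rightarrow>\<^sub>L 'y::real_inner"
  shows "bounded_linear (L_op B P x)"
  unfolding L_op_def[abs_def]
  by (intro bounded_linear_compose[OF blinfun.bounded_linear_right]
      hilbert_adjoint_bounded_linear blinfun.bounded_linear_right)

text \<open>Subtracting \<open>P x B\<^sup>* L\<^bsup>-1\<^esup> B (P x v)\<close> from \<open>P x v\<close> removes its component under \<open>B\<close>,
  because \<open>B P x B\<^sup>* = L\<close>, and changes nothing if \<open>P x v\<close> is already in the kernel of \<open>B\<close>.\<close>

lemma PB_op_projection:
  fixes B :: "'e::{real_inner, complete_space} \<Rightarrow>\<^sub>L 'y::{real_inner, complete_space}"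
  assumes idem: "P x o\<^sub>L P x = P x"
    and C: "0 < C" and coer: "\<And>\<delta>. C * (norm \<delta>)\<^sup>2 \<le> L_op B P x \<delta> \<bullet> \<delta>"
  shows "bounded_linear (PB_op B P x)"
    and "PB_op B P x v \<in> range (blinfun_apply (P x)) \<inter> {v. blinfun_apply B v = 0}"
    and "u \<in> range (blinfun_apply (P x)) \<inter> {v. blinfun_apply B v = 0} \<Longrightarrow> PB_op B P x u = u"
proof -
  note L = lax_milgram[OF bounded_linear_L_op C coer]
  show "bounded_linear (PB_op B P x)"
    unfolding PB_op_def[abs_def]
    by (intro bounded_linear_sub bounded_linear_compose[OF blinfun.bounded_linear_right]
        bounded_linear_compose[OF hilbert_adjoint_bounded_linear[OF blinfun.bounded_linear_right]]
        bounded_linear_compose[OF L(2)] blinfun.bounded_linear_right)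
  have "L_op B P x (inv (L_op B P x) y) = y" for y
    using L(1) by (simp add: bij_is_surj surj_f_inv_f)
  then have "blinfun_apply B (PB_op B P x v) = 0"
    by (simp add: PB_op_def blinfun.diff_right L_op_def)
  then show "PB_op B P x v \<in> range (blinfun_apply (P x)) \<inter> {v. blinfun_apply B v = 0}"
    by (auto simp: PB_op_def simp flip: blinfun.diff_right)
  assume u: "u \<in> range (blinfun_apply (P x)) \<inter> {v. blinfun_apply B v = 0}"
  then have "P x u = u" using idem by (metis IntD1 blinfun_apply_blinfun_compose imageE)
  then show "PB_op B P x u = u"
    using u linear_0[OF bounded_linear.linear[OF L(2)]]
      linear_0[OF bounded_linear.linear[OF hilbert_adjoint_bounded_linear[OF blinfun.bounded_linear_right[of B]]]]
    by (simp add: PB_op_def blinfun.zero_right)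
qed

text \<open>Let \<open>g\<close> be the orthogonal projection of \<open>h\<close> to \<open>S\<close>. The adjoint \<open>Q\<^sup>*\<close> of a projection
  onto \<open>S\<close> kills the orthogonal complement of \<open>S\<close>, so \<open>s = Q\<^sup>* h = Q\<^sup>* g\<close>. For \<open>u\<close> in \<open>S\<close>,
  \<open>u \<bullet> u = u \<bullet> Q\<^sup>* u\<close> gives \<open>norm u \<le> norm (Q\<^sup>* u)\<close>, while \<open>norm (Q\<^sup>* u) \<le> K * norm u\<close> always
  holds. Since \<open>Q s \<bullet> g = s \<bullet> s\<close>, everything follows by combining these two bounds.\<close>

lemma projection_gradient_estimates:
  fixes Q :: "'e::{real_inner, complete_space} \<Rightarrow> 'e"
  assumes Q: "bounded_linear Q" and K: "0 < K" "onorm Q \<le> K"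
    and range: "\<And>v. Q v \<in> S" and fixed: "\<And>u. u \<in> S \<Longrightarrow> Q u = u"
    and S: "subspace S" and g: "g \<in> S" "\<And>v. v \<in> S \<Longrightarrow> g \<bullet> v = h \<bullet> v"
  shows "adjoint Q h = adjoint Q g"
    and "Q (adjoint Q h) \<bullet> g = (norm (adjoint Q h))\<^sup>2"
    and "inj_on (\<lambda>v. Q (adjoint Q v)) S"
    and "norm g \<le> norm (adjoint Q h)"
    and "norm (adjoint Q h) \<le> K * norm g"
    and "norm g \<le> norm (Q (adjoint Q h))"
    and "norm (Q (adjoint Q h)) \<le> K\<^sup>2 * norm g"
    and "1 / K\<^sup>2 * norm (Q (adjoint Q h)) * norm g \<le> Q (adjoint Q h) \<bullet> g"
proof -
  interpret Q: bounded_linear Q by (rule Q)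
  interpret A: bounded_linear "adjoint Q" by (rule hilbert_adjoint_bounded_linear[OF Q])
  note aw = hilbert_adjoint_works[OF Q]
  have QA: "Q (adjoint Q v) \<bullet> u = adjoint Q v \<bullet> adjoint Q u" for u v
    by (simp add: aw)
  show hg: "adjoint Q h = adjoint Q g"
  proof (subst vector_eq_ldot[symmetric], rule allI)
    fix v
    show "v \<bullet> adjoint Q h = v \<bullet> adjoint Q g"
      using g(2)[OF range[of v]] by (simp add: aw inner_commute)
  qed
  define s where "s = adjoint Q h"
  define G where "G = Q s"
  have Gg: "G \<bullet> g = (norm s)\<^sup>2" by (simp add: G_def s_def hg QA power2_norm_eq_inner)
  have coer: "u \<bullet> u = u \<bullet> adjoint Q u" if "u \<in> S" for u
    using fixed[OF that] by (simp add: aw)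
  have below: "norm u \<le> norm (adjoint Q u)" if "u \<in> S" for u
    using coercive_cancel[of 1 u "adjoint Q u"] coer[OF that]
    by (simp add: power2_norm_eq_inner inner_commute)
  show "inj_on (\<lambda>v. Q (adjoint Q v)) S"
  proof (rule inj_onI)
    fix u v assume uv: "u \<in> S" "v \<in> S" "Q (adjoint Q u) = Q (adjoint Q v)"
    then have "Q (adjoint Q (u - v)) = 0" by (simp add: A.diff Q.diff)
    then have "adjoint Q (u - v) = 0" using QA[of "u - v" "u - v"] by simp
    then show "u = v" using below[of "u - v"] S uv by (simp add: subspace_diff)
  qed
  have above: "norm (adjoint Q u) \<le> K * norm u" for u
    using hilbert_adjoint_norm_le[OF Q, of u] K(2) by (meson mult_right_mono norm_ge_zero order.trans)
  have gs: "norm g \<le> norm s" using below[OF g(1)] by (simp add: s_def hg)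
  have sg: "norm s \<le> K * norm g" using above[of g] by (simp add: s_def hg)
  have GK: "norm G \<le> K\<^sup>2 * norm g"
  proof -
    have "norm G \<le> K * norm s"
      unfolding G_def using onorm[OF Q, of s] K(2) by (meson mult_right_mono norm_ge_zero order.trans)
    also have "\<dots> \<le> K * (K * norm g)" using sg K by (intro mult_left_mono) auto
    finally show ?thesis by (simp add: power2_eq_square)
  qed
  have gG: "norm g \<le> norm G"
  proof -
    have "(norm g)\<^sup>2 \<le> (norm s)\<^sup>2" using gs by (intro power_mono) auto
    then show ?thesis using coercive_cancel[of 1 g G] Gg by simp
  qed
  have "norm G * norm g \<le> K\<^sup>2 * norm g * norm g"
    using GK by (intro mult_right_mono) auto
  also have "\<dots> \<le> K\<^sup>2 * (norm s)\<^sup>2"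
    using gs by (simp add: power2_eq_square[of "norm s"] mult.assoc mult_left_mono mult_mono)
  finally have "norm G * norm g \<le> K\<^sup>2 * (norm s)\<^sup>2" .
  then have Gg2: "1 / K\<^sup>2 * norm G * norm g \<le> G \<bullet> g" using K by (simp add: Gg field_simps)
  show "Q (adjoint Q h) \<bullet> g = (norm (adjoint Q h))\<^sup>2"
    "norm g \<le> norm (adjoint Q h)" "norm (adjoint Q h) \<le> K * norm g"
    "norm g \<le> norm (Q (adjoint Q h))" "norm (Q (adjoint Q h)) \<le> K\<^sup>2 * norm g"
    "1 / K\<^sup>2 * norm (Q (adjoint Q h)) * norm g \<le> Q (adjoint Q h) \<bullet> g"
    using Gg gs sg gG GK Gg2 by (simp_all add: G_def s_def)
qed


theorem corollary6p1:
  fixes M X :: "'e::{real_inner, complete_space} set"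
    and B :: "'e \<Rightarrow>\<^sub>L 'y::{real_inner, complete_space}"
    and c :: 'y
    and P :: "'e \<Rightarrow> 'e \<Rightarrow>\<^sub>L 'e"
    and J :: "'e \<Rightarrow> real"
    and K :: real
  assumes submanifold: "C2_submanifold M"
    and surj_B: "surj (blinfun_apply B)"
    and nonempty: "constrained_set M B c \<noteq> {}"
    and proj_range: "\<And>x. x \<in> M \<Longrightarrow> range (blinfun_apply (P x)) = tangent_space M x"
    and proj_idem: "\<And>x. x \<in> M \<Longrightarrow> P x o\<^sub>L P x = P x"
    and A1: "\<And>S. S \<subseteq> constrained_set M B c \<Longrightarrow> bounded S \<Longrightarrow>
      \<exists>C>0. \<forall>x\<in>S. \<forall>\<delta>. L_op B P x \<delta> \<bullet> \<delta> \<ge> C * (norm \<delta>)\<^sup>2"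
    and A2_continuous: "continuous_on M P"
    and A2_bounded: "\<And>S. S \<subseteq> M \<Longrightarrow> bounded S \<Longrightarrow> bounded (P ` S)"
    and X_subset: "X \<subseteq> constrained_set M B c"
    and X_bounded: "bounded X"
    and K_pos: "K > 0"
    and K_bound: "\<And>x. x \<in> X \<Longrightarrow> onorm (PB_op B P x) \<le> K"
    and J_C2: "C2_on J UNIV"
  shows "\<forall>x\<in>X.
    (let gB = riemannian_grad J (constrained_set M B c) x; G = G_vec B P J x in
      norm gB \<le> norm_g_tilde M B c P x G \<and>
      norm_g_tilde M B c P x G = norm (adjoint (PB_op B P x) (grad J x)) \<and>
      norm (adjoint (PB_op B P x) (grad J x)) \<le> K * norm gB \<and>
      norm gB \<le> norm G \<and>
      norm G \<le> K\<^sup>2 * norm gB \<and>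
      G \<bullet> gB \<ge> 1 / K\<^sup>2 * norm G * norm gB)"
proof
  fix x assume x: "x \<in> X"
  define S where "S = tangent_space (constrained_set M B c) x"
  define Q where "Q = PB_op B P x"
  define h where "h = grad J x"
  have xc: "x \<in> constrained_set M B c" and xM: "x \<in> M"
    using x X_subset by (auto simp: constrained_set_def)
  obtain C where C: "0 < C" and coer: "\<And>\<delta>. C * (norm \<delta>)\<^sup>2 \<le> L_op B P x \<delta> \<bullet> \<delta>"
    using A1[of "{x}"] xc by auto
  have S: "S = range (blinfun_apply (P x)) \<inter> {v. blinfun_apply B v = 0}"
    unfolding S_def using tangent_space_constrained_set[OF submanifold xc _ C coer] proj_range[OF xM]
    by simp
  note PB = PB_op_projection[of P x, OF proj_idem[OF xM] C coer, folded S Q_def]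
  \<comment> \<open>As the fixed space of a bounded projection, \<open>S\<close> is a closed subspace.\<close>
  have S_fixed: "S = {v. Q v = v}" using PB(2,3) by (metis (mono_tags) Collect_eqI Collect_mem_eq)
  have "closed S"
    unfolding S_fixed by (intro closed_Collect_eq bounded_linear.continuous_on[OF PB(1)] continuous_intros)
  have "subspace S"
    unfolding S_fixed using bounded_linear.linear[OF PB(1)]
    by (auto simp: subspace_def linear_0 linear_add linear_scale)
  obtain g where g: "g \<in> S" "\<And>v. v \<in> S \<Longrightarrow> g \<bullet> v = h \<bullet> v"
    using riesz_on_subspace[OF bounded_linear_inner_right \<open>subspace S\<close> \<open>closed S\<close>, of h] by blast
  have gB: "riemannian_grad J (constrained_set M B c) x = g"
    unfolding riemannian_grad_def S_def[symmetric] h_def[symmetric]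
  proof (rule the_equality)
    fix g' assume g': "g' \<in> S \<and> (\<forall>v\<in>S. g' \<bullet> v = h \<bullet> v)"
    then have "g' - g \<in> S" using \<open>subspace S\<close> g(1) by (simp add: subspace_diff)
    then have "(g' - g) \<bullet> (g' - g) = 0" using g' g(2) by (simp add: inner_diff_left)
    then show "g' = g" by simp
  qed (use g in blast)
  note est = projection_gradient_estimates[OF PB(1) K_pos K_bound[OF x, folded Q_def] PB(2,3)
      \<open>subspace S\<close> g]
  have G: "G_vec B P J x = Q (adjoint Q h)" by (simp add: G_vec_def Q_def h_def)
  \<comment> \<open>The operator \<open>Q Q\<^sup>*\<close> sends \<open>g\<close> to \<open>Q Q\<^sup>* g = Q Q\<^sup>* h\<close>, so injectivity identifies the
    preimage that defines the modified norm.\<close>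
  have "inv_into S (A_op B P x) (Q (adjoint Q h)) = g"
  proof -
    have A: "A_op B P x = (\<lambda>v. Q (adjoint Q v))" by (simp add: A_op_def Q_def fun_eq_iff)
    show ?thesis using inv_into_f_f[OF est(3) g(1)] by (simp add: A est(1))
  qed
  then have "norm_g_tilde M B c P x (Q (adjoint Q h)) = norm (adjoint Q h)"
    using est(2) by (simp add: norm_g_tilde_def g_tilde_def S_def inner_commute)
  then show "let gB = riemannian_grad J (constrained_set M B c) x; G = G_vec B P J x in
      norm gB \<le> norm_g_tilde M B c P x G \<and>
      norm_g_tilde M B c P x G = norm (adjoint (PB_op B P x) (grad J x)) \<and>
      norm (adjoint (PB_op B P x) (grad J x)) \<le> K * norm gB \<and>
      norm gB \<le> norm G \<and>
      norm G \<le> K\<^sup>2 * norm gB \<and>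
      G \<bullet> gB \<ge> 1 / K\<^sup>2 * norm G * norm gB"
    using est(4-8) unfolding Let_def gB G by (simp add: Q_def h_def)
qed

end
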